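(* In the standing setting of the context, assume that there exists an open neighborhood $\mathcal{N}(t_0)\subset(0,1)^m$ of $t_0$ such that, for any $t\in\mathcal{N}(t_0)$, the $\phi$-projection of $t$ on $\mathcal{M}=\mathcal{S}(\bar\Theta)$ exists and is unique. Then the function $\vartheta^*:\mathcal{N}(t_0)\to\bar\Theta$ defined by $$\vartheta^*(t)=\operatorname*{arg\,inf}_{\theta\in\bar\Theta}D_\phi(\mathcal{S}(\theta)\mid t)$$ is continuous at $t_0$.
   Context: Fix a positive integer $m$. The function $\phi:[0,\infty)\to\mathbb{R}$ is convex and continuous at $0$. Define $f:[0,\infty)^2\to\mathbb{R}\cup\{\infty\}$ by $f(v,w)=w\,\phi(v/w)$ if $v\ge 0$, $w>0$; $f(v,0)=v\lim_{x\to\infty}\phi(x)/x$ if $v>0$ (the limit exists in $\mathbb{R}\cup\{\infty\}$); and $f(0,0)=0$. For $s,t\in[0,\infty)^m$, $D_\phi(s\mid t)=\sum_{i=1}^m f(s_i,t_i)$. A $\phi$-projection of $t$ on a nonempty set $\mathcal{M}$ is an element $s^*\in\mathcal{M}$ with $D_\phi(s^*\mid t)=\inf_{s\in\mathcal{M}}D_\phi(s\mid t)$. Standing assumptions: $\phi$ is strictly convex and twice continuously differentiable on $(0,\infty)$. For some positive integer $k\le m$, $\Theta\subset\mathbb{R}^k$ is bounded, with closure $\bar\Theta$ and nonempty interior $\mathring\Theta$; $\mathcal{S}:\bar\Theta\to[0,1]^m$ is continuous, injective, twice continuously differentiable on $\mathring\Theta$, and satisfies $\mathcal{S}(\mathring\Theta)\subset(0,1)^m$;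 and $\mathcal{M}=\mathcal{S}(\bar\Theta)$. A point $t_0\in(0,1)^m$ is fixed. Since $\mathcal{S}$ is injective, $\vartheta^*(t)$ is the unique $\theta\in\bar\Theta$ such that $\mathcal{S}(\theta)$ is the unique $\phi$-projection of $t$ on $\mathcal{M}$. *)

theory Defs
  imports "HOL-Analysis.Analysis"
begin

definition strictly_convex_on :: "'a::real_vector set \<Rightarrow> ('a \<Rightarrow> real) \<Rightarrow> bool"
  where "strictly_convex_on A f \<longleftrightarrow> convex A \<and>
    (\<forall>x\<in>A. \<forall>y\<in>A. \<forall>u::real. x \<noteq> y \<longrightarrow> 0 < u \<longrightarrow> u < 1 \<longrightarrow>
       f ((1 - u) *\<^sub>R x + u *\<^sub>R y) < (1 - u) * f x + u * f y)"

(* Frechet sense; meant for open A *)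
definition twice_continuously_differentiable_on ::
    "'a::real_normed_vector set \<Rightarrow> ('a \<Rightarrow> 'b::real_normed_vector) \<Rightarrow> bool"
  where "twice_continuously_differentiable_on A f \<longleftrightarrow>
    (\<exists>(f' :: 'a \<Rightarrow> 'a \<Rightarrow>\<^sub>L 'b) (f'' :: 'a \<Rightarrow> 'a \<Rightarrow>\<^sub>L 'a \<Rightarrow>\<^sub>L 'b).
       (\<forall>x\<in>A. (f has_derivative blinfun_apply (f' x)) (at x)) \<and>
       (\<forall>x\<in>A. (f' has_derivative blinfun_apply (f'' x)) (at x)) \<and>
       continuous_on A f'')"

(* Only arguments v, w \<ge> 0 are meaningful. The limit is taken in ereal, where it exists
   for every convex \<phi>. *)
definition phi_perspective :: "(real \<Rightarrow> real) \<Rightarrow> real \<Rightarrow> real \<Rightarrow> ereal"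
  where "phi_perspective \<phi> v w =
    (if w > 0 then ereal (w * \<phi> (v / w))
     else if v > 0 then ereal v * Lim at_top (\<lambda>x. ereal (\<phi> x / x))
     else 0)"

definition phi_divergence :: "(real \<Rightarrow> real) \<Rightarrow> real ^ 'm \<Rightarrow> real ^ 'm \<Rightarrow> ereal"
  where "phi_divergence \<phi> s t = (\<Sum>i\<in>UNIV. phi_perspective \<phi> (s $ i) (t $ i))"

definition is_phi_projection ::
    "(real \<Rightarrow> real) \<Rightarrow> real ^ 'm \<Rightarrow> (real ^ 'm) set \<Rightarrow> real ^ 'm \<Rightarrow> bool"
  where "is_phi_projection \<phi> t M s \<longleftrightarrow>
    s \<in> M \<and> phi_divergence \<phi> s t = (INF s'\<in>M. phi_divergence \<phi> s' t)"

(* Arbitrary unless the infimum is attained at exactly one point of closure \<Theta>. *)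
definition vartheta_star ::
    "(real \<Rightarrow> real) \<Rightarrow> (real ^ 'k) set \<Rightarrow> (real ^ 'k \<Rightarrow> real ^ 'm) \<Rightarrow> real ^ 'm \<Rightarrow> real ^ 'k"
  where "vartheta_star \<phi> \<Theta> S t =
    (THE \<theta>. \<theta> \<in> closure \<Theta> \<and>
       phi_divergence \<phi> (S \<theta>) t = (INF \<theta>'\<in>closure \<Theta>. phi_divergence \<phi> (S \<theta>') t))"

lemma is_phi_projection_image:
  assumes "\<theta> \<in> closure \<Theta>"
  shows "is_phi_projection \<phi> t (S ` closure \<Theta>) (S \<theta>) \<longleftrightarrow>
    phi_divergence \<phi> (S \<theta>) t = (INF \<theta>'\<in>closure \<Theta>. phi_divergence \<phi> (S \<theta>') t)"
  using assms by (simp add: is_phi_projection_def image_image)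

lemma vartheta_star_eq_iff:
  assumes inj: "inj_on S (closure \<Theta>)"
    and unique: "\<exists>!s. is_phi_projection \<phi> t (S ` closure \<Theta>) s"
  shows "vartheta_star \<phi> \<Theta> S t = \<theta> \<longleftrightarrow>
    \<theta> \<in> closure \<Theta> \<and> is_phi_projection \<phi> t (S ` closure \<Theta>) (S \<theta>)"
proof -
  let ?P = "\<lambda>\<theta>. \<theta> \<in> closure \<Theta> \<and> is_phi_projection \<phi> t (S ` closure \<Theta>) (S \<theta>)"
  have eq: "vartheta_star \<phi> \<Theta> S t = (THE \<theta>. ?P \<theta>)"
    unfolding vartheta_star_def
    by (rule arg_cong[where f = The]) (auto simp: is_phi_projection_image)
  obtain s where s: "is_phi_projection \<phi> t (S ` closure \<Theta>) s"
    using unique by blast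
  then obtain \<theta>0 where "\<theta>0 \<in> closure \<Theta>" "s = S \<theta>0"
    by (auto simp: is_phi_projection_def)
  with s have "?P \<theta>0" by simp
  moreover have "\<theta> = \<theta>0" if "?P \<theta>" for \<theta>
    using that \<open>?P \<theta>0\<close> unique inj by (metis inj_on_eq_iff)
  ultimately have ex1: "\<exists>!\<theta>. ?P \<theta>" by blast
  show ?thesis
    unfolding eq using theI'[OF ex1] the1_equality[OF ex1] by metis
qed

end

theory Submission
  imports Defs
begin

text \<open>For \<open>t\<close> with positive coordinates the divergence of \<open>S \<theta>\<close> from \<open>t\<close> is finite and
jointly continuous in \<open>\<theta>\<close> and \<open>t\<close>, since a convex function continuous at the left endpoint is
continuous on all of \<open>[0, \<infinity>)\<close>. As the closure of \<open>\<Theta>\<close> is compact, minimisers for \<open>t\<^sub>n \<rightarrow> t\<^sub>0\<close>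
accumulate only at minimisers for \<open>t\<^sub>0\<close>, and there is only one of these.\<close>

text \<open>If \<open>v\<close> were discontinuous, some \<open>t n\<close> tending to
  \<open>t0\<close> would keep \<open>v (t n)\<close> away from \<open>v t0\<close>. By compactness
  a subsequence of these minimisers converges, and its limit minimises at \<open>t0\<close>, hence
  is \<open>v t0\<close>. Uniqueness matters only at \<open>t0\<close>; elsewhere \<open>v\<close>
  may select any minimiser.\<close>

lemma argmin_continuous_within:
  fixes g :: "'a::metric_space \<Rightarrow> 'b::metric_space \<Rightarrow> real"
  assumes K: "compact K"
    and g: "continuous_on (K \<times> T) (\<lambda>(x, t). g x t)"
    and t0: "t0 \<in> T"
    and v: "\<And>t. t \<in> T \<Longrightarrow> v t \<in> K"
    and le: "\<And>t x. t \<in> T \<Longrightarrow> x \<in> K \<Longrightarrow> g (v t) t \<le> g x t"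
    and unique: "\<And>x. x \<in> K \<Longrightarrow> (\<And>y. y \<in> K \<Longrightarrow> g x t0 \<le> g y t0) \<Longrightarrow> x = v t0"
  shows "continuous (at t0 within T) v"
proof (rule ccontr)
  assume "\<not> continuous (at t0 within T) v"
  then obtain e where e: "e > 0"
    and "\<And>d. d > 0 \<Longrightarrow> \<exists>t\<in>T. dist t t0 < d \<and> \<not> dist (v t) (v t0) < e"
    unfolding continuous_within_eps_delta by blast
  then have "\<forall>n. \<exists>t\<in>T. dist t t0 < inverse (real (Suc n)) \<and> \<not> dist (v t) (v t0) < e"
    by simp
  then obtain t where tT: "\<And>n. t n \<in> T" and dt: "\<And>n. dist (t n) t0 < inverse (real (Suc n))"
    and far: "\<And>n. \<not> dist (v (t n)) (v t0) < e"
    by metis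
  have t_lim: "t \<longlonglongrightarrow> t0"
    by (rule iffD2[OF tendsto_dist_iff],
        rule tendsto_sandwich[OF _ _ tendsto_const LIMSEQ_inverse_real_of_nat])
      (use dt in \<open>auto intro!: always_eventually less_imp_le\<close>)
  have "\<forall>n. v (t n) \<in> K"
    using v tT by blast
  then obtain l r where l: "l \<in> K" and r: "strict_mono r" and "((\<lambda>n. v (t n)) \<circ> r) \<longlonglongrightarrow> l"
    using K seq_compactE[of K "\<lambda>n. v (t n)"] by (auto simp: compact_eq_seq_compact_metric)
  then have vl: "(\<lambda>n. v (t (r n))) \<longlonglongrightarrow> l"
    by (simp add: o_def)
  have tr: "(\<lambda>n. t (r n)) \<longlonglongrightarrow> t0"
    using LIMSEQ_subseq_LIMSEQ[OF t_lim r] by (simp add: o_def)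
  \<comment> \<open>Stated for an arbitrary sequence \<open>x\<close> so that it serves both sides
    of the limiting inequality: the minimisers \<open>v (t (r n))\<close> and a constant
    competitor.\<close>
  have lim: "(\<lambda>n. g (x n) (t (r n))) \<longlonglongrightarrow> g y t0"
    if "x \<longlonglongrightarrow> y" "\<And>n. x n \<in> K" "y \<in> K" for x y
    using continuous_on_tendsto_compose[OF g tendsto_Pair[OF that(1) tr]] that t0 tT
    by simp
  have "g l t0 \<le> g y t0" if "y \<in> K" for y
    by (rule LIMSEQ_le[OF lim[OF vl v[OF tT] l] lim[OF tendsto_const]])
      (use that le tT in auto)
  then have "l = v t0"
    using unique l by blast
  then have "eventually (\<lambda>n. dist (v (t (r n))) (v t0) < e) sequentially"
    using tendstoD[OF vl e] by simp
  then show False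
    using far by simp
qed

text \<open>Convexity gives continuity on the open half-line, but a convex function may jump upwards
  at the endpoint \<open>a\<close>, so continuity there is a hypothesis.\<close>

lemma convex_on_Ici_continuous:
  fixes f :: "real \<Rightarrow> real"
  assumes "convex_on {a..} f" and "continuous (at a within {a..}) f"
  shows "continuous_on {a..} f"
proof -
  have "convex_on {a<..} f"
    by (rule convex_on_subset[OF assms(1)]) auto
  then have "continuous_on {a<..} f"
    by (intro convex_on_continuous) auto
  then have "continuous (at x within {a..}) f" if "x > a" for x
    using that by (simp add: continuous_on_eq_continuous_at continuous_at_imp_continuous_at_within)
  with assms(2) show ?thesis
    by (auto simp: continuous_on_eq_continuous_within order_le_less)
qed

text \<open>Positive \<open>t $ i\<close> select the first branch of \<open>phi_perspective\<close>,
  so the limit of \<open>\<phi> x / x\<close> never enters and a real-valued objective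
  suffices.\<close>

lemma phi_divergence_pos:
  assumes "\<And>i. t $ i > 0"
  shows "phi_divergence \<phi> s t = ereal (\<Sum>i\<in>UNIV. t $ i * \<phi> (s $ i / t $ i))"
  using assms by (simp add: phi_divergence_def phi_perspective_def)

lemma is_phi_projection_iff_minimal:
  "is_phi_projection \<phi> t M s \<longleftrightarrow>
    s \<in> M \<and> (\<forall>s'\<in>M. phi_divergence \<phi> s t \<le> phi_divergence \<phi> s' t)"
  unfolding is_phi_projection_def
  by (auto intro!: antisym INF_greatest INF_lower simp: le_INF_iff)

theorem proposition15:
  fixes \<phi> :: "real \<Rightarrow> real"
    and \<Theta> :: "(real ^ 'k) set"
    and S :: "real ^ 'k \<Rightarrow> real ^ 'm"
    and t\<^sub>0 :: "real ^ 'm"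
    and N :: "(real ^ 'm) set"
  assumes "convex_on {0..} \<phi>"
    and "continuous (at 0 within {0..}) \<phi>"
    and "strictly_convex_on {0<..} \<phi>"
    and "twice_continuously_differentiable_on {0<..} \<phi>"
    and "CARD('k) \<le> CARD('m)"
    and "bounded \<Theta>"
    and "interior \<Theta> \<noteq> {}"
    and "S ` closure \<Theta> \<subseteq> cbox 0 1"
    and "continuous_on (closure \<Theta>) S"
    and "inj_on S (closure \<Theta>)"
    and "twice_continuously_differentiable_on (interior \<Theta>) S"
    and "S ` interior \<Theta> \<subseteq> box 0 1"
    and "t\<^sub>0 \<in> box 0 1"
    and "open N" and "t\<^sub>0 \<in> N" and "N \<subseteq> box 0 1"
    and "\<And>t. t \<in> N \<Longrightarrow> \<exists>!s. is_phi_projection \<phi> t (S ` closure \<Theta>) s"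
  shows "continuous (at t\<^sub>0 within N) (vartheta_star \<phi> \<Theta> S)"
proof (rule argmin_continuous_within[where K = "closure \<Theta>"
      and g = "\<lambda>\<theta> t. \<Sum>i\<in>UNIV. t $ i * \<phi> (S \<theta> $ i / t $ i)"])
  let ?v = "vartheta_star \<phi> \<Theta> S"
  have pos: "0 < t $ i" if "t \<in> N" for t i
    using that assms(16) by (auto simp: mem_box_cart)
  have nonneg: "0 \<le> S \<theta> $ i" if "\<theta> \<in> closure \<Theta>" for \<theta> i
    using that assms(8) by (auto simp: mem_box_cart)
  \<comment> \<open>Injectivity of \<open>S\<close> turns the unique projection into a unique
    parameter. Membership, minimality and uniqueness of the minimiser are all read off from this
    equivalence.\<close>
  have min_iff: "?v t = \<theta> \<longleftrightarrow> \<theta> \<in> closure \<Theta> \<and> (\<forall>\<theta>'\<in>closure \<Theta>.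
      (\<Sum>i\<in>UNIV. t $ i * \<phi> (S \<theta> $ i / t $ i)) \<le> (\<Sum>i\<in>UNIV. t $ i * \<phi> (S \<theta>' $ i / t $ i)))"
    if "t \<in> N" for t \<theta>
    unfolding vartheta_star_eq_iff[OF assms(10) assms(17)[OF that]] is_phi_projection_iff_minimal
      phi_divergence_pos[OF pos[OF that]] by auto
  show "compact (closure \<Theta>)"
    using assms(6) by simp
  show "t\<^sub>0 \<in> N" by fact
  show "?v t \<in> closure \<Theta>" if "t \<in> N" for t
    using min_iff[OF that] by blast
  show "(\<Sum>i\<in>UNIV. t $ i * \<phi> (S (?v t) $ i / t $ i)) \<le> (\<Sum>i\<in>UNIV. t $ i * \<phi> (S \<theta> $ i / t $ i))"
    if "t \<in> N" "\<theta> \<in> closure \<Theta>" for t \<theta>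
    using min_iff[OF that(1)] that(2) by blast
  show "\<theta> = ?v t\<^sub>0"
    if "\<theta> \<in> closure \<Theta>" "\<And>\<theta>'. \<theta>' \<in> closure \<Theta> \<Longrightarrow> (\<Sum>i\<in>UNIV. t\<^sub>0 $ i * \<phi> (S \<theta> $ i / t\<^sub>0 $ i))
      \<le> (\<Sum>i\<in>UNIV. t\<^sub>0 $ i * \<phi> (S \<theta>' $ i / t\<^sub>0 $ i))" for \<theta>
    using min_iff[OF assms(15), of \<theta>] that by simp
  have S: "continuous_on (closure \<Theta> \<times> N) (\<lambda>p. S (fst p))"
    by (rule continuous_on_compose2[OF assms(9)]) (auto intro!: continuous_intros)
  have "continuous_on (closure \<Theta> \<times> N) (\<lambda>p. S (fst p) $ i / snd p $ i)" for i
    using pos by (intro continuous_intros S) (auto simp: less_le)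
  \<comment> \<open>The quotient may be \<open>0\<close>, since \<open>S\<close> maps the closure
    only into the closed cube; this is where continuity of \<open>\<phi>\<close> at \<open>0\<close>
    enters.\<close>
  moreover have "(\<lambda>p. S (fst p) $ i / snd p $ i) ` (closure \<Theta> \<times> N) \<subseteq> {0..}" for i
    using pos nonneg by (auto intro!: divide_nonneg_pos)
  ultimately have "continuous_on (closure \<Theta> \<times> N) (\<lambda>p. \<phi> (S (fst p) $ i / snd p $ i))" for i
    using continuous_on_compose2[OF convex_on_Ici_continuous[OF assms(1,2)]] by blast
  then show "continuous_on (closure \<Theta> \<times> N)
      (\<lambda>(\<theta>, t). \<Sum>i\<in>UNIV. t $ i * \<phi> (S \<theta> $ i / t $ i))"
    unfolding case_prod_beta by (intro continuous_intros)
qed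

end
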